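(* Let $d\ge 1$ be an integer, let $\lambda>0$ and $\kappa>0$, let $W=[0,\lambda]^d$, and let $A$ be a non-empty measurable hereditary set of finite point configurations in $W$. Let $Y$, $\widehat Y$ be the naive and conditional Monte Carlo estimators of $p^*=\mathbb{P}(\boldsymbol X\in A)$ (built from points generated under $\rho$), and let $\widetilde Y$ be the importance sampling estimator built from points generated under an importance sampling measure $\mu$ with weight $L$ taking values in $[0,1]$, all as defined in the context. Then $$\mathrm{Var}_\mu(\widetilde Y)\;\le\;\mathrm{Var}_\rho(\widehat Y)\;\le\;\mathrm{Var}_\rho(Y).$$
   Context: Configurations: $\mathscr G$ is the set of all finite subsets of $W=[0,\lambda]^d$ (with its Borel $\sigma$-algebra). A measurable set $A\subseteq\mathscr G$ is hereditary if $\boldsymbol x\subseteq \boldsymbol x'$ and $\boldsymbol x'\in A$ imply $\boldsymbol x\in A$. Poisson process: $\boldsymbol X$ is a homogeneous Poisson point process on $W$ of intensity $\kappa$. Put $\beta=\kappa\lambda^d$ and $q_n=e^{-\beta}\beta^n/n!$ for $n\in\mathbb Z_+=\{0,1,2,\dots\}$. Under $\rho$, $X_1,X_2,\dots$ are i.i.d. uniform on $W$. In all cases $\boldsymbol X_n=\{X_1,\dots,X_n\}$ (with $\boldsymbol X_0=\varnothing$). Importance sampling measure: $\mu$ is the law of a random sequence $X_1,X_2,\dots$ of points in $W$ generated sequentially (each point may depend on the previous ones, and the generation may be stopped at a random time, in which case $\mathbb I(\boldsymbol X_n\in A)=0$ for all later $n$), and $L$ is a measurable $[0,1]$-valued function of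 ordered finite tuples of points whose underlying configuration is in $A$, with $L(\varnothing)=1$; one writes $L(\boldsymbol X_n)$ for $L(X_1,\dots,X_n)$. $L$ is the Radon–Nikodym derivative of $\rho$ with respect to $\mu$ on $A$: for every $n\ge 0$ and every bounded measurable $f:W^n\to\mathbb R$, $$\mathbb E_\rho[f(X_1,\dots,X_n)\,\mathbb I(\boldsymbol X_n\in A)]=\mathbb E_\mu[f(X_1,\dots,X_n)\,\mathbb I(\boldsymbol X_n\in A)\,L(\boldsymbol X_n)].$$ Estimators: - $Y=\mathbb I(\boldsymbol X\in A)$, with $\boldsymbol X$ the Poisson process (number of points $N\sim\mathrm{Poisson}(\beta)$ and, given $N=n$, points distributed as $\boldsymbol X_n$ under $\rho$); - $\widehat Y=\sum_{n\in\mathbb Z_+}q_n\,\mathbb I(\boldsymbol X_n\in A)$ with $X_1,X_2,\dots$ generated under $\rho$; - $\widetilde Y=\sum_{n\in\mathbb Z_+}q_n\,\mathbb I(\boldsymbol X_n\in A)\,L(\boldsymbol X_n)$ with $X_1,X_2,\dots$ generated under $\mu$. Subscripts $\rho,\mu$ on $\mathbb E$, $\mathrm{Var}$ indicate the law of the points used. *)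

theory Defs
  imports "HOL-Probability.Probability"
begin

definition window :: "real \<Rightarrow> (real ^ 'd) set" where
  "window lam = {x. \<forall>i. 0 \<le> x $ i \<and> x $ i \<le> lam}"

definition points :: "real \<Rightarrow> (real ^ 'd) measure" where
  "points lam = restrict_space borel (window lam)"

definition tuples :: "real \<Rightarrow> nat \<Rightarrow> (nat \<Rightarrow> real ^ 'd) measure" where
  "tuples lam n = (\<Pi>\<^sub>M i\<in>{..<n}. points lam)"

text \<open>The Borel \<open>\<sigma>\<close>-algebra on the finite configurations is the one generated by the counting
  maps \<open>x \<mapsto> card (x \<inter> B)\<close>, \<open>B\<close> Borel, as usual in point process theory.\<close>

definition configs :: "real \<Rightarrow> (real ^ 'd) set measure" where
  "configs lam =
     sigma {x. finite x \<and> x \<subseteq> window lam}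
       {{x. finite x \<and> x \<subseteq> window lam \<and> card (x \<inter> B) = k} | B k. B \<in> sets borel}"

definition hereditary :: "'a set set \<Rightarrow> bool" where
  "hereditary A \<longleftrightarrow> (\<forall>x x'. x \<subseteq> x' \<and> x' \<in> A \<longrightarrow> x \<in> A)"

text \<open>Sequences of points are indexed from 0, so what is usually written \<open>X\<^sub>1, \<dots>, X\<^sub>n\<close> is the sequence of
  values at \<open>0, \<dots>, n - 1\<close>.\<close>

definition config :: "nat \<Rightarrow> (nat \<Rightarrow> 'a) \<Rightarrow> 'a set" where
  "config n x = x ` {..<n}"

definition unif_seq :: "real \<Rightarrow> (nat \<Rightarrow> real ^ 'd) measure" where
  "unif_seq lam =
     (\<Pi>\<^sub>M i\<in>UNIV. uniform_measure (restrict_space lborel (window lam)) (window lam))"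

definition poisson_weight :: "real \<Rightarrow> nat \<Rightarrow> real" where
  "poisson_weight \<beta> n = exp (- \<beta>) * \<beta> ^ n / fact n"

text \<open>A Poisson process of intensity \<open>\<kappa>\<close> on the window: the number of points is Poisson with
  parameter \<open>\<kappa> * lam ^ CARD('d)\<close> and, given that it is \<open>n\<close>, the configuration is distributed
  like the set of the first \<open>n\<close> points of an i.i.d. uniform sequence.\<close>

definition poisson_process ::
  "real \<Rightarrow> real \<Rightarrow> 'p measure \<Rightarrow> ('p \<Rightarrow> (real ^ 'd) set) \<Rightarrow> bool" where
  "poisson_process lam \<kappa> P X \<longleftrightarrow>
     prob_space P \<and>
     X \<in> P \<rightarrow>\<^sub>M configs lam \<and>
     distr P (count_space UNIV) (\<lambda>\<omega>. card (X \<omega>)) =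
       measure_pmf (poisson_pmf (\<kappa> * lam ^ CARD('d))) \<and>
     (\<forall>n. \<forall>E \<in> sets (configs lam).
        \<P>(\<omega> in P. X \<omega> \<in> E \<bar> card (X \<omega>) = n) = \<P>(x in unif_seq lam. config n x \<in> E))"

text \<open>In the sampler, \<open>T\<close> is the (possibly infinite) number of points generated before stopping;
  the values \<open>X i \<omega>\<close> with \<open>i \<ge> T \<omega>\<close> play no role, because the indicator of the event that the
  \<open>n\<close>-point configuration is in \<open>A\<close> is 0 for \<open>n > T \<omega>\<close>.\<close>

definition alive :: "'a set set \<Rightarrow> nat \<Rightarrow> (nat \<Rightarrow> 'a) \<Rightarrow> enat \<Rightarrow> real" where
  "alive A n x t = of_bool (enat n \<le> t \<and> config n x \<in> A)"

text \<open>The weight \<open>L\<close> is the family of its restrictions \<open>L n\<close> to \<open>n\<close>-tuples; it is constrained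
  only on tuples whose underlying configuration is in \<open>A\<close>.\<close>

definition importance_sampler ::
  "real \<Rightarrow> (real ^ 'd) set set \<Rightarrow> 'm measure \<Rightarrow> (nat \<Rightarrow> 'm \<Rightarrow> real ^ 'd) \<Rightarrow> ('m \<Rightarrow> enat) \<Rightarrow>
   (nat \<Rightarrow> (nat \<Rightarrow> real ^ 'd) \<Rightarrow> real) \<Rightarrow> bool" where
  "importance_sampler lam A \<mu> X T L \<longleftrightarrow>
     prob_space \<mu> \<and>
     (\<forall>i. X i \<in> \<mu> \<rightarrow>\<^sub>M points lam) \<and>
     T \<in> \<mu> \<rightarrow>\<^sub>M count_space UNIV \<and>
     (\<forall>n. L n \<in> borel_measurable (restrict_space (tuples lam n) {x. config n x \<in> A})) \<and>
     (\<forall>n. \<forall>x \<in> space (tuples lam n). config n x \<in> A \<longrightarrow> 0 \<le> L n x \<and> L n x \<le> 1) \<and>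
     L 0 (\<lambda>_. undefined) = 1 \<and>
     (\<forall>n. \<forall>f \<in> borel_measurable (tuples lam n). bounded (f ` space (tuples lam n)) \<longrightarrow>
        (\<integral>x. f (restrict x {..<n}) * indicator A (config n x) \<partial>unif_seq lam) =
        (\<integral>\<omega>. f (\<lambda>i\<in>{..<n}. X i \<omega>) * alive A n (\<lambda>i. X i \<omega>) (T \<omega>) * L n (\<lambda>i\<in>{..<n}. X i \<omega>) \<partial>\<mu>))"

definition naive_estimator :: "'a set set \<Rightarrow> 'a set \<Rightarrow> real" where
  "naive_estimator A x = indicator A x"

definition conditional_estimator :: "real \<Rightarrow> 'a set set \<Rightarrow> (nat \<Rightarrow> 'a) \<Rightarrow> real" where
  "conditional_estimator \<beta> A x = (\<Sum>n. poisson_weight \<beta> n * indicator A (config n x))"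

definition importance_estimator ::
  "real \<Rightarrow> 'a set set \<Rightarrow> (nat \<Rightarrow> (nat \<Rightarrow> 'a) \<Rightarrow> real) \<Rightarrow> (nat \<Rightarrow> 'a) \<Rightarrow> enat \<Rightarrow> real" where
  "importance_estimator \<beta> A L x t =
     (\<Sum>n. poisson_weight \<beta> n * alive A n x t * L n (restrict x {..<n}))"

end

theory Submission imports Defs begin

text \<open>Write \<open>I\<^sub>n\<close> for the indicator that the first \<open>n\<close> points form a configuration in \<open>A\<close>, and
  \<open>p\<^sub>n\<close> for its mean under the uniform law. All three estimators have mean \<open>\<Sum>n. q\<^sub>n p\<^sub>n\<close>, so
  only second moments matter. For the naive estimator the second moment equals the mean, whereas the
  conditional estimator has values in \<open>[0, 1]\<close>. For the importance estimator, expand the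
  square: a product of two numbers in \<open>[0, 1]\<close> is at most either factor, so with
  \<open>k = max m n\<close> the \<open>(m, n)\<close> term is at most \<open>q\<^sub>m q\<^sub>n\<close> times the mean of \<open>I\<^sub>k L\<^sub>k\<close>, which is
  \<open>p\<^sub>k\<close>; since \<open>A\<close> is hereditary, \<open>p\<^sub>k\<close> is also the mean of \<open>I\<^sub>m I\<^sub>n\<close> under the uniform law.\<close>

section \<open>Mixtures of bounded random variables\<close>

lemma summable_weighted:
  fixes q u :: "nat \<Rightarrow> real"
  assumes "\<And>n. 0 \<le> q n" "summable q" "\<And>n. 0 \<le> u n" "\<And>n. u n \<le> 1"
  shows "summable (\<lambda>n. q n * u n)"
  by (rule summable_comparison_test'[OF assms(2), of 0])
     (use assms in \<open>auto simp: abs_mult intro!: mult_left_le\<close>)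

lemma weighted_mean_bounds:
  fixes q u :: "nat \<Rightarrow> real"
  assumes "\<And>n. 0 \<le> q n" "q sums 1" "\<And>n. 0 \<le> u n" "\<And>n. u n \<le> 1"
  shows "0 \<le> (\<Sum>n. q n * u n)" and "(\<Sum>n. q n * u n) \<le> 1"
proof -
  have s: "summable (\<lambda>n. q n * u n)"
    using assms by (intro summable_weighted) (auto simp: sums_iff)
  show "0 \<le> (\<Sum>n. q n * u n)"
    using assms by (intro suminf_nonneg s) auto
  have "(\<Sum>n. q n * u n) \<le> (\<Sum>n. q n)"
    using assms by (intro suminf_le s) (auto simp: sums_iff intro!: mult_left_le)
  then show "(\<Sum>n. q n * u n) \<le> 1"
    using assms by (simp add: sums_iff)
qed

context prob_space
begin

lemma integrable_unit_interval:
  fixes f :: "'a \<Rightarrow> real"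
  assumes "f \<in> borel_measurable M" "\<And>x. x \<in> space M \<Longrightarrow> 0 \<le> f x \<and> f x \<le> 1"
  shows "integrable M f"
  by (rule integrable_const_bound[where B = 1]) (use assms in auto)

lemma expectation_unit_interval:
  fixes f :: "'a \<Rightarrow> real"
  assumes "f \<in> borel_measurable M" "\<And>x. x \<in> space M \<Longrightarrow> 0 \<le> f x \<and> f x \<le> 1"
  shows "0 \<le> expectation f" and "expectation f \<le> 1"
proof -
  show "0 \<le> expectation f"
    using assms by (intro Bochner_Integration.integral_nonneg) auto
  have "expectation f \<le> expectation (\<lambda>_. 1)"
    using assms by (intro integral_mono integrable_unit_interval) auto
  then show "expectation f \<le> 1"
    by (simp add: prob_space)
qed

text \<open>Sum and integral may be exchanged because every term lies between 0 and
  \<open>q n\<close>. The extra factor \<open>V\<close> lets one interchange serve both moments: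
  \<open>V = 1\<close> gives the mean, while a mixture or one of its components gives the second
  moment.\<close>

lemma expectation_times_mixture:
  fixes q :: "nat \<Rightarrow> real" and U :: "nat \<Rightarrow> 'a \<Rightarrow> real" and V :: "'a \<Rightarrow> real"
  assumes q: "\<And>n. 0 \<le> q n" "q sums 1"
    and U: "\<And>n. U n \<in> borel_measurable M" "\<And>n x. x \<in> space M \<Longrightarrow> 0 \<le> U n x \<and> U n x \<le> 1"
    and V: "V \<in> borel_measurable M" "\<And>x. x \<in> space M \<Longrightarrow> 0 \<le> V x \<and> V x \<le> 1"
  shows "expectation (\<lambda>x. V x * (\<Sum>n. q n * U n x)) = (\<Sum>n. q n * expectation (\<lambda>x. V x * U n x))"
proof -
  have VU: "(\<lambda>x. V x * U n x) \<in> borel_measurable M"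
    "\<And>x. x \<in> space M \<Longrightarrow> 0 \<le> V x * U n x \<and> V x * U n x \<le> 1" for n
    using U V by (auto intro!: mult_le_one borel_measurable_times)
  have i: "integrable M (\<lambda>x. V x * U n x)" for n
    using VU by (rule integrable_unit_interval)
  have sq: "summable q"
    using q by (simp add: sums_iff)
  have "expectation (\<lambda>x. V x * (\<Sum>n. q n * U n x)) = expectation (\<lambda>x. \<Sum>n. q n * (V x * U n x))"
  proof (rule Bochner_Integration.integral_cong[OF refl])
    fix x assume x: "x \<in> space M"
    have "summable (\<lambda>n. q n * U n x)"
      using q(1) sq U(2)[OF x] by (intro summable_weighted) auto
    then show "V x * (\<Sum>n. q n * U n x) = (\<Sum>n. q n * (V x * U n x))"
      by (simp add: suminf_mult[symmetric] mult.left_commute)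
  qed
  \<comment> \<open>Absolute summability is required twice, pointwise and for the integrated norms.
    In both cases \<open>q\<close> is a summable majorant.\<close>
  also have "\<dots> = (\<Sum>n. expectation (\<lambda>x. q n * (V x * U n x)))"
  proof (rule integral_suminf)
    show "integrable M (\<lambda>x. q n * (V x * U n x))" for n
      using i by simp
    show "AE x in M. summable (\<lambda>n. norm (q n * (V x * U n x)))"
    proof (rule AE_I2)
      fix x assume x: "x \<in> space M"
      have "norm (q n * (V x * U n x)) = q n * (V x * U n x)" for n
        using q(1)[of n] VU(2)[OF x, of n] by simp
      then show "summable (\<lambda>n. norm (q n * (V x * U n x)))"
        using q(1) sq VU(2)[OF x] by (simp add: summable_weighted)
    qed
    have "expectation (\<lambda>x. norm (q n * (V x * U n x))) = q n * expectation (\<lambda>x. V x * U n x)" for n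
    proof -
      have "expectation (\<lambda>x. norm (q n * (V x * U n x))) = expectation (\<lambda>x. q n * (V x * U n x))"
      proof (rule Bochner_Integration.integral_cong[OF refl])
        fix x assume "x \<in> space M"
        then show "norm (q n * (V x * U n x)) = q n * (V x * U n x)"
          using q(1)[of n] VU(2)[of x n] by simp
      qed
      then show ?thesis by simp
    qed
    then show "summable (\<lambda>n. expectation (\<lambda>x. norm (q n * (V x * U n x))))"
      using q(1) sq expectation_unit_interval[OF VU] by (simp add: summable_weighted)
  qed
  finally show ?thesis
    by simp
qed

lemma mixture_measurable:
  fixes q :: "nat \<Rightarrow> real" and U :: "nat \<Rightarrow> 'a \<Rightarrow> real"
  assumes "\<And>n. U n \<in> borel_measurable M"
  shows "(\<lambda>x. \<Sum>n. q n * U n x) \<in> borel_measurable M"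
  using assms by measurable

lemma mixture_unit_interval:
  fixes q :: "nat \<Rightarrow> real" and U :: "nat \<Rightarrow> 'a \<Rightarrow> real"
  assumes q: "\<And>n. 0 \<le> q n" "q sums 1"
    and U: "\<And>n x. x \<in> space M \<Longrightarrow> 0 \<le> U n x \<and> U n x \<le> 1"
    and x: "x \<in> space M"
  shows "0 \<le> (\<Sum>n. q n * U n x) \<and> (\<Sum>n. q n * U n x) \<le> 1"
  using weighted_mean_bounds[OF q, of "\<lambda>n. U n x"] U[OF x] by simp

lemma expectation_mixture:
  fixes q :: "nat \<Rightarrow> real" and U :: "nat \<Rightarrow> 'a \<Rightarrow> real"
  assumes "\<And>n. 0 \<le> q n" "q sums 1"
    and "\<And>n. U n \<in> borel_measurable M" "\<And>n x. x \<in> space M \<Longrightarrow> 0 \<le> U n x \<and> U n x \<le> 1"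
  shows "expectation (\<lambda>x. \<Sum>n. q n * U n x) = (\<Sum>n. q n * expectation (U n))"
  using expectation_times_mixture[OF assms, of "\<lambda>_. 1"] by simp

text \<open>Two applications of the interchange: first one factor of the square is expanded with the
  whole mixture as \<open>V\<close>, then the other with \<open>V = U m\<close>. What remains
  depends only on the mixed moments of pairs.\<close>

lemma expectation_mixture_square:
  fixes q :: "nat \<Rightarrow> real" and U :: "nat \<Rightarrow> 'a \<Rightarrow> real"
  assumes q: "\<And>n. 0 \<le> q n" "q sums 1"
    and U: "\<And>n. U n \<in> borel_measurable M" "\<And>n x. x \<in> space M \<Longrightarrow> 0 \<le> U n x \<and> U n x \<le> 1"
  shows "expectation (\<lambda>x. (\<Sum>n. q n * U n x)\<^sup>2)
    = (\<Sum>m. q m * (\<Sum>n. q n * expectation (\<lambda>x. U m x * U n x)))"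
proof -
  let ?S = "\<lambda>x. \<Sum>n. q n * U n x"
  have "expectation (\<lambda>x. (?S x)\<^sup>2) = (\<Sum>m. q m * expectation (\<lambda>x. ?S x * U m x))"
    unfolding power2_eq_square
    by (rule expectation_times_mixture[OF q U mixture_measurable mixture_unit_interval])
       (use q U in auto)
  moreover have "expectation (\<lambda>x. ?S x * U m x) = (\<Sum>n. q n * expectation (\<lambda>x. U m x * U n x))" for m
    using expectation_times_mixture[OF q U U] by (simp add: mult.commute)
  ultimately show ?thesis by simp
qed

lemma variance_unit_interval:
  fixes f :: "'a \<Rightarrow> real"
  assumes "f \<in> borel_measurable M" "\<And>x. x \<in> space M \<Longrightarrow> 0 \<le> f x \<and> f x \<le> 1"
  shows "variance f = expectation (\<lambda>x. (f x)\<^sup>2) - (expectation f)\<^sup>2"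
  using assms
  by (intro variance_eq integrable_unit_interval) (auto simp: power_le_one)

end

text \<open>The double series for the two second moments carry the same nonnegative weights, so they
  can be compared term by term. The families may live on different probability spaces, as the points
  under \<mu> and under the uniform law do.\<close>

lemma expectation_mixture_square_mono:
  fixes q :: "nat \<Rightarrow> real" and U :: "nat \<Rightarrow> 'a \<Rightarrow> real" and V :: "nat \<Rightarrow> 'b \<Rightarrow> real"
  assumes M: "prob_space M" and N: "prob_space N"
    and q: "\<And>n. 0 \<le> q n" "q sums 1"
    and U: "\<And>n. U n \<in> borel_measurable M" "\<And>n x. x \<in> space M \<Longrightarrow> 0 \<le> U n x \<and> U n x \<le> 1"
    and V: "\<And>n. V n \<in> borel_measurable N" "\<And>n x. x \<in> space N \<Longrightarrow> 0 \<le> V n x \<and> V n x \<le> 1"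
    and le: "\<And>m n. (\<integral>x. U m x * U n x \<partial>M) \<le> (\<integral>x. V m x * V n x \<partial>N)"
  shows "(\<integral>x. (\<Sum>n. q n * U n x)\<^sup>2 \<partial>M) \<le> (\<integral>x. (\<Sum>n. q n * V n x)\<^sup>2 \<partial>N)"
proof -
  have sq: "summable q"
    using q by (simp add: sums_iff)
  have u: "0 \<le> (\<integral>x. U m x * U n x \<partial>M)" "(\<integral>x. U m x * U n x \<partial>M) \<le> 1" for m n
    using U by (auto intro!: prob_space.expectation_unit_interval[OF M] mult_le_one
        borel_measurable_times)
  have v: "0 \<le> (\<integral>x. V m x * V n x \<partial>N)" "(\<integral>x. V m x * V n x \<partial>N) \<le> 1" for m n
    using V by (auto intro!: prob_space.expectation_unit_interval[OF N] mult_le_one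
        borel_measurable_times)
  have inner: "(\<Sum>n. q n * (\<integral>x. U m x * U n x \<partial>M)) \<le> (\<Sum>n. q n * (\<integral>x. V m x * V n x \<partial>N))" for m
    by (rule suminf_le) (use q(1) sq u v le in \<open>auto intro!: summable_weighted mult_left_mono\<close>)
  \<comment> \<open>The outer series converge because each inner sum is a weighted mean of numbers
    in [0, 1].\<close>
  have "(\<Sum>m. q m * (\<Sum>n. q n * (\<integral>x. U m x * U n x \<partial>M)))
      \<le> (\<Sum>m. q m * (\<Sum>n. q n * (\<integral>x. V m x * V n x \<partial>N)))"
    by (rule suminf_le)
       (use q sq u v inner in \<open>auto intro!: summable_weighted mult_left_mono weighted_mean_bounds\<close>)
  then show ?thesis
    by (simp add: prob_space.expectation_mixture_square[OF M q U]
        prob_space.expectation_mixture_square[OF N q V])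
qed

section \<open>Poisson weights\<close>

lemma poisson_weight_nonneg: "0 \<le> \<beta> \<Longrightarrow> 0 \<le> poisson_weight \<beta> n"
  by (simp add: poisson_weight_def)

lemma poisson_weight_sums: "poisson_weight \<beta> sums 1"
proof -
  have "(\<lambda>n. exp (- \<beta>) * (\<beta> ^ n /\<^sub>R fact n)) sums (exp (- \<beta>) * exp \<beta>)"
    by (intro sums_mult exp_converges)
  then show ?thesis
    by (simp add: poisson_weight_def[abs_def] exp_minus field_simps)
qed

section \<open>Measurability of configurations\<close>

lemma config_restrict [simp]: "config n (restrict x {..<n}) = config n x"
  by (simp add: config_def)

lemma config_mono: "m \<le> n \<Longrightarrow> config m x \<subseteq> config n x"
  by (auto simp: config_def)

lemma space_points: "space (points lam) = window lam"
  by (simp add: points_def space_restrict_space)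

lemma configs_generator_subset:
  "{{x. finite x \<and> x \<subseteq> window lam \<and> card (x \<inter> B) = k} | B k. B \<in> sets borel}
    \<subseteq> Pow {x. finite x \<and> x \<subseteq> window lam}"
  by auto

lemma space_configs: "space (configs lam) = {x. finite x \<and> x \<subseteq> window lam}"
  unfolding configs_def by (rule space_measure_of[OF configs_generator_subset])

text \<open>Points may coincide, so an index is counted only at the first occurrence of its value.
  This turns the cardinality of a set into a finite sum of indicators, from which measurability can
  be read off.\<close>

lemma card_config_Int:
  "card (config n x \<inter> B) = (\<Sum>i<n. of_bool (x i \<in> B \<and> (\<forall>j<i. x j \<noteq> x i)))"
proof (induction n)
  case 0
  then show ?case by (simp add: config_def)
next
  case (Suc n)
  have "config (Suc n) x \<inter> B = (if x n \<in> B then insert (x n) (config n x \<inter> B) else config n x \<inter> B)"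
    by (auto simp: config_def lessThan_Suc)
  moreover have "x n \<in> config n x \<longleftrightarrow> \<not> (\<forall>j<n. x j \<noteq> x n)"
    unfolding config_def image_iff by (metis lessThan_iff)
  moreover have "finite (config n x \<inter> B)"
    by (simp add: config_def)
  ultimately show ?case
    using Suc by (auto simp: card_insert_if)
qed

lemma config_measurable_random:
  fixes X :: "nat \<Rightarrow> 'a \<Rightarrow> real ^ 'd"
  assumes X: "\<And>i. i < n \<Longrightarrow> X i \<in> M \<rightarrow>\<^sub>M points lam"
  shows "(\<lambda>\<omega>. config n (\<lambda>i. X i \<omega>)) \<in> M \<rightarrow>\<^sub>M configs lam"
  unfolding configs_def
proof (rule measurable_measure_of[OF configs_generator_subset])
  show "(\<lambda>\<omega>. config n (\<lambda>i. X i \<omega>)) \<in> space M \<rightarrow> {x. finite x \<and> x \<subseteq> window lam}"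
    using measurable_space[OF X] by (auto simp: config_def space_points)
next
  fix E :: "(real ^ 'd) set set"
  assume "E \<in> {{x. finite x \<and> x \<subseteq> window lam \<and> card (x \<inter> B) = k} | B k. B \<in> sets borel}"
  then obtain B k where B [measurable]: "B \<in> sets borel"
    and E: "E = {x. finite x \<and> x \<subseteq> window lam \<and> card (x \<inter> B) = k}"
    by blast
  \<comment> \<open>As Borel maps into a second countable space, any two of the \<open>X i\<close>
    have a measurable coincidence event, which the first-occurrence test requires.\<close>
  have [measurable]: "X i \<in> borel_measurable M" if "i < n" for i
    using X[OF that] by (simp add: points_def measurable_restrict_space2_iff)
  have "(\<lambda>\<omega>. \<Sum>i<n. of_bool (X i \<omega> \<in> B \<and> (\<forall>j<i. X j \<omega> \<noteq> X i \<omega>)) :: nat)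
      \<in> M \<rightarrow>\<^sub>M count_space UNIV"
  proof (rule measurable_sum_nat)
    fix i assume "i \<in> {..<n}"
    then have i: "i < n" "\<And>j. j < i \<Longrightarrow> j < n" by auto
    show "(\<lambda>\<omega>. of_bool (X i \<omega> \<in> B \<and> (\<forall>j<i. X j \<omega> \<noteq> X i \<omega>)) :: nat)
        \<in> M \<rightarrow>\<^sub>M count_space UNIV"
      using i by measurable
  qed
  then have "{\<omega> \<in> space M. card (config n (\<lambda>i. X i \<omega>) \<inter> B) = k} \<in> sets M"
    unfolding card_config_Int by measurable
  moreover have "(\<lambda>\<omega>. config n (\<lambda>i. X i \<omega>)) -` E \<inter> space M
      = {\<omega> \<in> space M. card (config n (\<lambda>i. X i \<omega>) \<inter> B) = k}"
    using measurable_space[OF X] by (auto simp: E config_def space_points)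
  ultimately show "(\<lambda>\<omega>. config n (\<lambda>i. X i \<omega>)) -` E \<inter> space M \<in> sets M"
    by simp
qed

lemma config_measurable_tuples: "config n \<in> tuples lam n \<rightarrow>\<^sub>M configs lam"
proof -
  have "(\<lambda>x. config n (\<lambda>i. x i)) \<in> tuples lam n \<rightarrow>\<^sub>M configs lam"
    unfolding tuples_def by (intro config_measurable_random measurable_component_singleton) auto
  then show ?thesis by simp
qed

text \<open>Normalizing a measure leaves its measurable sets unchanged, and Lebesgue measure has the
  Borel sets.\<close>

lemma sets_unif_seq:
  "sets (unif_seq lam :: (nat \<Rightarrow> real ^ 'd) measure) = sets (\<Pi>\<^sub>M i\<in>UNIV. points lam)"
  unfolding unif_seq_def
  by (intro sets_PiM_cong refl) (simp add: points_def sets_restrict_space)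

lemma config_measurable_unif_seq:
  "config n \<in> (unif_seq lam :: (nat \<Rightarrow> real ^ 'd) measure) \<rightarrow>\<^sub>M configs lam"
proof -
  have "(\<lambda>x. config n (\<lambda>i. x i)) \<in> (\<Pi>\<^sub>M i\<in>UNIV. points lam :: (real ^ 'd) measure) \<rightarrow>\<^sub>M configs lam"
    by (intro config_measurable_random measurable_component_singleton) auto
  then show ?thesis
    by (simp add: measurable_cong_sets[OF sets_unif_seq refl])
qed

text \<open>The total number of points is the counting map for \<open>B = UNIV\<close>. The target
  is countable, so preimages of singletons suffice.\<close>

lemma card_measurable_configs: "card \<in> configs lam \<rightarrow>\<^sub>M count_space UNIV"
proof -
  have "card -` {k} \<inter> space (configs lam) \<in> sets (configs lam)" for k :: nat
  proof -
    have "card -` {k} \<inter> space (configs lam)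
        = {x. finite x \<and> x \<subseteq> window lam \<and> card (x \<inter> UNIV) = k}"
      by (auto simp: space_configs)
    also have "\<dots> \<in> sets (configs lam)"
      unfolding configs_def sets_measure_of[OF configs_generator_subset]
      by (intro sigma_sets.Basic CollectI exI[of _ UNIV] exI[of _ k]) auto
    finally show ?thesis .
  qed
  then show ?thesis
    by (auto simp: measurable_count_space_eq2_countable)
qed

text \<open>The window is a cube of volume \<open>lam ^ CARD('d)\<close>, which is positive and
  finite, so the uniform law on it is normalized.\<close>

lemma prob_space_unif_seq:
  assumes "lam > 0"
  shows "prob_space (unif_seq lam :: (nat \<Rightarrow> real ^ 'd) measure)"
proof -
  have w: "window lam = cbox (0 :: real ^ 'd) (\<chi> i. lam)"
    by (auto simp: window_def mem_box_cart)
  have s: "window lam \<in> sets (lborel :: (real ^ 'd) measure)"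
    unfolding w by simp
  have "emeasure lborel (window lam :: (real ^ 'd) set) = ennreal (lam ^ CARD('d))"
  proof -
    have "emeasure lborel (cbox (0 :: real ^ 'd) (\<chi> i. lam)) =
        ennreal (\<Prod>b\<in>Basis. ((\<chi> i. lam) - (0 :: real ^ 'd)) \<bullet> b)"
      using assms by (intro emeasure_lborel_cbox) (auto simp: Basis_vec_def inner_axis)
    also have "(\<Prod>b\<in>Basis. ((\<chi> i. lam) - (0 :: real ^ 'd)) \<bullet> b) = (\<Prod>b\<in>(Basis :: (real ^ 'd) set). lam)"
      by (intro prod.cong refl) (auto simp: Basis_vec_def inner_axis)
    finally show ?thesis
      by (simp add: w)
  qed
  then have "emeasure (restrict_space lborel (window lam)) (window lam :: (real ^ 'd) set)
      = ennreal (lam ^ CARD('d))"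
    using s by (simp add: emeasure_restrict_space)
  then have "prob_space (uniform_measure (restrict_space lborel (window lam))
      (window lam :: (real ^ 'd) set))"
    using assms by (intro prob_space_uniform_measure) auto
  then show ?thesis
    unfolding unif_seq_def by (intro prob_space_PiM)
qed

section \<open>The estimators\<close>

text \<open>Total probability over the number of points. It expresses the mean of the naive
  estimator through the same uniform sequence that drives the conditional one.\<close>

lemma poisson_process_prob:
  fixes X :: "'p \<Rightarrow> (real ^ 'd) set"
  assumes X: "poisson_process lam \<kappa> P X" and A: "A \<in> sets (configs lam)"
    and \<beta>: "\<beta> = \<kappa> * lam ^ CARD('d)" "\<beta> > 0"
  shows "measure P {\<omega> \<in> space P. X \<omega> \<in> A}
    = (\<Sum>n. poisson_weight \<beta> n * measure (unif_seq lam) {x \<in> space (unif_seq lam). config n x \<in> A})"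
proof -
  from X interpret P: prob_space P
    by (simp add: poisson_process_def)
  have XM [measurable]: "X \<in> P \<rightarrow>\<^sub>M configs lam"
    and card: "distr P (count_space UNIV) (\<lambda>\<omega>. card (X \<omega>)) = measure_pmf (poisson_pmf \<beta>)"
    and cond: "\<And>n. \<P>(\<omega> in P. X \<omega> \<in> A \<bar> card (X \<omega>) = n) = \<P>(x in unif_seq lam. config n x \<in> A)"
    using X A by (auto simp: poisson_process_def \<beta>)
  have [measurable]: "(\<lambda>\<omega>. card (X \<omega>)) \<in> P \<rightarrow>\<^sub>M count_space UNIV"
    using measurable_compose[OF XM card_measurable_configs] .
  note A [measurable]
  have n: "\<P>(\<omega> in P. card (X \<omega>) = n) = poisson_weight \<beta> n" for n
  proof -
    have "\<P>(\<omega> in P. card (X \<omega>) = n) = measure (distr P (count_space UNIV) (\<lambda>\<omega>. card (X \<omega>))) {n}"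
      by (subst measure_distr) (auto intro!: arg_cong[where f = "measure P"])
    also have "\<dots> = poisson_weight \<beta> n"
      using \<beta>(2) by (simp add: card measure_pmf_single poisson_weight_def field_simps)
    finally show ?thesis .
  qed
  have An: "measure P {\<omega> \<in> space P. X \<omega> \<in> A \<and> card (X \<omega>) = n}
      = poisson_weight \<beta> n * \<P>(x in unif_seq lam. config n x \<in> A)" for n
  proof -
    \<comment> \<open>A conditional probability is a quotient here; the positive denominator allows
      it to be cleared, giving the joint probability.\<close>
    have "poisson_weight \<beta> n > 0"
      using \<beta>(2) by (simp add: poisson_weight_def)
    then show ?thesis
      using cond[of n] by (simp add: cond_prob_def n field_simps)
  qed
  have "(\<lambda>n. measure P {\<omega> \<in> space P. X \<omega> \<in> A \<and> card (X \<omega>) = n})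
      sums measure P (\<Union>n. {\<omega> \<in> space P. X \<omega> \<in> A \<and> card (X \<omega>) = n})"
    by (rule P.finite_measure_UNION) (auto simp: disjoint_family_on_def)
  moreover have "(\<Union>n. {\<omega> \<in> space P. X \<omega> \<in> A \<and> card (X \<omega>) = n}) = {\<omega> \<in> space P. X \<omega> \<in> A}"
    by auto
  ultimately show ?thesis
    by (simp add: An sums_iff)
qed

text \<open>Initial segments give nested configurations, so membership in \<open>A\<close> at the
  larger index forces it at the smaller one.\<close>

lemma hereditary_indicator_mult:
  assumes "hereditary A"
  shows "indicator A (config m x) * indicator A (config n x)
    = (indicator A (config (max m n) x) :: real)"
proof -
  have "config (max m n) x \<in> A \<Longrightarrow> config m x \<in> A \<and> config n x \<in> A"
    using assms config_mono[of m "max m n" x] config_mono[of n "max m n" x]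
    unfolding hereditary_def by (meson max.cobounded1 max.cobounded2)
  then show ?thesis
    by (cases "m \<le> n") (auto simp: indicator_def max_def split: if_splits)
qed

section \<open>Weighted indicators under the importance sampling law\<close>

context
  fixes lam :: real and A :: "(real ^ 'd) set set" and \<mu> :: "'m measure"
    and Z :: "nat \<Rightarrow> 'm \<Rightarrow> real ^ 'd" and T :: "'m \<Rightarrow> enat"
    and L :: "nat \<Rightarrow> (nat \<Rightarrow> real ^ 'd) \<Rightarrow> real"
  assumes A: "A \<in> sets (configs lam)"
    and sampler: "importance_sampler lam A \<mu> Z T L"
begin

text \<open>The counterpart under \<mu> of the indicator of \<open>config n x \<in> A\<close>.
  Indicator and weight are kept together because \<open>L n\<close> is controlled only where the
  configuration is in \<open>A\<close>; off that set the product is 0.\<close>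

definition weighted_alive :: "nat \<Rightarrow> 'm \<Rightarrow> real" where
  "weighted_alive n \<omega> = alive A n (\<lambda>i. Z i \<omega>) (T \<omega>) * L n (\<lambda>i\<in>{..<n}. Z i \<omega>)"

lemma tuple_measurable: "(\<lambda>\<omega>. \<lambda>i\<in>{..<n}. Z i \<omega>) \<in> \<mu> \<rightarrow>\<^sub>M tuples lam n"
  using sampler unfolding tuples_def importance_sampler_def by (intro measurable_restrict) auto

lemma weight_unit_interval:
  assumes "\<omega> \<in> space \<mu>" "alive A n (\<lambda>i. Z i \<omega>) (T \<omega>) \<noteq> 0"
  shows "0 \<le> L n (\<lambda>i\<in>{..<n}. Z i \<omega>) \<and> L n (\<lambda>i\<in>{..<n}. Z i \<omega>) \<le> 1"
  using sampler measurable_space[OF tuple_measurable assms(1), of n] assms(2)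
  by (auto simp: importance_sampler_def alive_def)

lemma weighted_alive_unit_interval:
  assumes "\<omega> \<in> space \<mu>"
  shows "0 \<le> weighted_alive n \<omega> \<and> weighted_alive n \<omega> \<le> 1"
  using weight_unit_interval[OF assms, of n]
  by (cases "alive A n (\<lambda>i. Z i \<omega>) (T \<omega>) = 0") (auto simp: weighted_alive_def alive_def)

lemma weighted_alive_measurable: "weighted_alive n \<in> borel_measurable \<mu>"
proof -
  have T [measurable]: "T \<in> \<mu> \<rightarrow>\<^sub>M count_space UNIV"
    and L: "L n \<in> borel_measurable (restrict_space (tuples lam n) {x. config n x \<in> A})"
    using sampler by (auto simp: importance_sampler_def)
  have "{x. config n x \<in> A} \<inter> space (tuples lam n) \<in> sets (tuples lam n)"
    using measurable_sets[OF config_measurable_tuples A, of n]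
    by (simp add: vimage_def Int_commute)
  \<comment> \<open>Extension by zero: \<open>L n\<close> is measurable only on the tuples with
    configuration in \<open>A\<close>, a measurable set of tuples.\<close>
  then have "(\<lambda>x. indicator {x. config n x \<in> A} x *\<^sub>R L n x) \<in> borel_measurable (tuples lam n)"
    using L by (simp add: borel_measurable_restrict_space_iff)
  from measurable_compose[OF tuple_measurable this]
  have [measurable]: "(\<lambda>\<omega>. indicator {x. config n x \<in> A} (\<lambda>i\<in>{..<n}. Z i \<omega>)
      *\<^sub>R L n (\<lambda>i\<in>{..<n}. Z i \<omega>)) \<in> borel_measurable \<mu>" .
  have "weighted_alive n = (\<lambda>\<omega>. of_bool (enat n \<le> T \<omega>) *
      (indicator {x. config n x \<in> A} (\<lambda>i\<in>{..<n}. Z i \<omega>) *\<^sub>R L n (\<lambda>i\<in>{..<n}. Z i \<omega>)))"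
    by (auto simp: weighted_alive_def alive_def fun_eq_iff)
  also have "\<dots> \<in> borel_measurable \<mu>"
    by measurable
  finally show ?thesis .
qed

lemma expectation_weighted_alive:
  "(\<integral>\<omega>. weighted_alive n \<omega> \<partial>\<mu>) = (\<integral>x. indicator A (config n x) \<partial>unif_seq lam)"
proof -
  have "\<forall>f\<in>borel_measurable (tuples lam n). bounded (f ` space (tuples lam n)) \<longrightarrow>
      (\<integral>x. f (restrict x {..<n}) * indicator A (config n x) \<partial>unif_seq lam) =
      (\<integral>\<omega>. f (\<lambda>i\<in>{..<n}. Z i \<omega>) * alive A n (\<lambda>i. Z i \<omega>) (T \<omega>) * L n (\<lambda>i\<in>{..<n}. Z i \<omega>) \<partial>\<mu>)"
    using sampler unfolding importance_sampler_def by blast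
  \<comment> \<open>The Radon-Nikodym identity is tested on the constant function 1.\<close>
  from bspec[OF this, of "\<lambda>_. 1"] show ?thesis
    by (auto simp: weighted_alive_def image_constant_conv)
qed

text \<open>The factor with the larger index is the one retained, since its mean is the probability
  that heredity identifies with the mixed moment of the unweighted indicators.\<close>

lemma weighted_alive_mult_le:
  assumes "\<omega> \<in> space \<mu>"
  shows "weighted_alive m \<omega> * weighted_alive n \<omega> \<le> weighted_alive (max m n) \<omega>"
  using weighted_alive_unit_interval[OF assms, of m] weighted_alive_unit_interval[OF assms, of n]
  by (cases "m \<le> n") (auto simp: max_def intro: mult_left_le mult_left_le_one_le)

end

theorem proposition1:
  fixes lam \<kappa> \<beta> :: real
    and A :: "(real ^ 'd) set set"
    and P :: "'p measure" and X :: "'p \<Rightarrow> (real ^ 'd) set"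
    and \<mu> :: "'m measure" and Z :: "nat \<Rightarrow> 'm \<Rightarrow> real ^ 'd" and T :: "'m \<Rightarrow> enat"
    and L :: "nat \<Rightarrow> (nat \<Rightarrow> real ^ 'd) \<Rightarrow> real"
  assumes "lam > 0" and "\<kappa> > 0"
    and "\<beta> = \<kappa> * lam ^ CARD('d)"
    and "A \<in> sets (configs lam)" and "A \<noteq> {}" and "hereditary A"
    and "poisson_process lam \<kappa> P X"
    and "importance_sampler lam A \<mu> Z T L"
  shows "prob_space.variance \<mu> (\<lambda>\<omega>. importance_estimator \<beta> A L (\<lambda>i. Z i \<omega>) (T \<omega>))
           \<le> prob_space.variance (unif_seq lam) (conditional_estimator \<beta> A)
       \<and> prob_space.variance (unif_seq lam) (conditional_estimator \<beta> A)
           \<le> prob_space.variance P (\<lambda>\<omega>. naive_estimator A (X \<omega>))"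
proof -
  note lam = assms(1) and A = assms(4) and her = assms(6) and X = assms(7) and sampler = assms(8)
  have \<beta>: "\<beta> > 0"
    using assms(1-3) by simp
  let ?U = "unif_seq lam :: (nat \<Rightarrow> real ^ 'd) measure"
  let ?I = "\<lambda>n x. indicator A (config n x) :: real"
  let ?V = "weighted_alive A Z T L"
  define q where "q = poisson_weight \<beta>"
  \<comment> \<open>The mean common to all three estimators. Each variance thus becomes a second
    moment minus \<open>p\<^sup>2\<close>.\<close>
  define p where "p = (\<Sum>n. q n * (\<integral>x. ?I n x \<partial>?U))"
  have q: "\<And>n. 0 \<le> q n" "q sums 1"
    using \<beta> by (auto simp: q_def poisson_weight_nonneg poisson_weight_sums)
  interpret \<mu>: prob_space \<mu>
    using sampler by (simp add: importance_sampler_def)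
  interpret U: prob_space ?U
    by (rule prob_space_unif_seq[OF lam])
  interpret P: prob_space P
    using X by (simp add: poisson_process_def)

  have I: "?I n \<in> borel_measurable ?U" for n
    using A by (intro measurable_compose[OF config_measurable_unif_seq] borel_measurable_indicator)
  have I01: "0 \<le> ?I n x \<and> ?I n x \<le> 1" for n x
    by (simp add: indicator_def)
  have cond: "conditional_estimator \<beta> A = (\<lambda>x. \<Sum>n. q n * ?I n x)"
    by (simp add: conditional_estimator_def q_def fun_eq_iff)
  note cond_meas = U.mixture_measurable[of ?I q, OF I]
  note cond01 = U.mixture_unit_interval[of q ?I, OF q I01]
  have cond_mean: "U.expectation (conditional_estimator \<beta> A) = p"
    unfolding cond p_def by (rule U.expectation_mixture[OF q I I01])
  have cond_var: "U.variance (conditional_estimator \<beta> A)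
      = U.expectation (\<lambda>x. (conditional_estimator \<beta> A x)\<^sup>2) - p\<^sup>2"
    using U.variance_unit_interval[OF cond_meas cond01] cond_mean unfolding cond by simp

  note V = weighted_alive_measurable[OF A sampler]
  note V01 = weighted_alive_unit_interval[OF A sampler]
  have imp: "importance_estimator \<beta> A L (\<lambda>i. Z i \<omega>) (T \<omega>) = (\<Sum>n. q n * ?V n \<omega>)" for \<omega>
    by (simp add: importance_estimator_def q_def weighted_alive_def[OF A sampler] mult.assoc)
  note imp_meas = \<mu>.mixture_measurable[of ?V q, OF V]
  note imp01 = \<mu>.mixture_unit_interval[of q ?V, OF q V01]
  have imp_mean: "\<mu>.expectation (\<lambda>\<omega>. \<Sum>n. q n * ?V n \<omega>) = p"
    unfolding p_def expectation_weighted_alive[OF A sampler, symmetric]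
    by (rule \<mu>.expectation_mixture[OF q V V01])
  have imp_var: "\<mu>.variance (\<lambda>\<omega>. \<Sum>n. q n * ?V n \<omega>)
      = \<mu>.expectation (\<lambda>\<omega>. (\<Sum>n. q n * ?V n \<omega>)\<^sup>2) - p\<^sup>2"
    using \<mu>.variance_unit_interval[OF imp_meas imp01] by (simp add: imp_mean)
  have "\<mu>.expectation (\<lambda>\<omega>. (\<Sum>n. q n * ?V n \<omega>)\<^sup>2) \<le> U.expectation (\<lambda>x. (\<Sum>n. q n * ?I n x)\<^sup>2)"
  proof (rule expectation_mixture_square_mono[OF \<mu>.prob_space_axioms U.prob_space_axioms q V V01 I I01])
    fix m n
    \<comment> \<open>The mixed moment under \<mu> is bounded by a single mean; the change of
      measure removes the weight, and heredity then splits the resulting indicator back into a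
      product.\<close>
    have "\<mu>.expectation (\<lambda>\<omega>. ?V m \<omega> * ?V n \<omega>) \<le> \<mu>.expectation (?V (max m n))"
      using V V01 weighted_alive_mult_le[OF A sampler]
      by (intro integral_mono \<mu>.integrable_unit_interval) (auto intro!: mult_le_one)
    also have "\<dots> = U.expectation (\<lambda>x. ?I m x * ?I n x)"
      by (simp add: expectation_weighted_alive[OF A sampler] hereditary_indicator_mult[OF her])
    finally show "\<mu>.expectation (\<lambda>\<omega>. ?V m \<omega> * ?V n \<omega>) \<le> U.expectation (\<lambda>x. ?I m x * ?I n x)" .
  qed
  \<comment> \<open>With equal means, the order of the second moments is the order of the
    variances.\<close>
  then have 1: "\<mu>.variance (\<lambda>\<omega>. importance_estimator \<beta> A L (\<lambda>i. Z i \<omega>) (T \<omega>))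
      \<le> U.variance (conditional_estimator \<beta> A)"
    by (simp only: imp imp_var cond_var) (simp add: cond)

  have XM: "X \<in> P \<rightarrow>\<^sub>M configs lam"
    using X by (simp add: poisson_process_def)
  have naive: "naive_estimator A (X \<omega>) = indicator {\<omega> \<in> space P. X \<omega> \<in> A} \<omega>"
    if "\<omega> \<in> space P" for \<omega>
    using that by (simp add: naive_estimator_def indicator_def)
  have naive_meas: "(\<lambda>\<omega>. naive_estimator A (X \<omega>)) \<in> borel_measurable P"
    unfolding naive_estimator_def using A by (intro measurable_compose[OF XM] borel_measurable_indicator)
  \<comment> \<open>Links the probabilities in the total probability formula to the integrals in the
    definition of \<open>p\<close>.\<close>
  have p_n: "measure ?U {x \<in> space ?U. config n x \<in> A} = (\<integral>x. ?I n x \<partial>?U)" for n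
  proof -
    have "(\<integral>x. ?I n x \<partial>?U) = (\<integral>x. indicator {x \<in> space ?U. config n x \<in> A} x \<partial>?U)"
      by (intro Bochner_Integration.integral_cong) (auto simp: indicator_def)
    moreover have "{x \<in> space ?U. config n x \<in> A} \<inter> space ?U = {x \<in> space ?U. config n x \<in> A}"
      by auto
    ultimately show ?thesis by simp
  qed
  have naive_mean: "P.expectation (\<lambda>\<omega>. naive_estimator A (X \<omega>)) = p"
  proof -
    have "P.expectation (\<lambda>\<omega>. naive_estimator A (X \<omega>)) = measure P {\<omega> \<in> space P. X \<omega> \<in> A}"
    proof -
      have "P.expectation (\<lambda>\<omega>. naive_estimator A (X \<omega>))
          = P.expectation (indicator {\<omega> \<in> space P. X \<omega> \<in> A})"
        by (intro Bochner_Integration.integral_cong refl naive)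
      moreover have "{\<omega> \<in> space P. X \<omega> \<in> A} \<inter> space P = {\<omega> \<in> space P. X \<omega> \<in> A}"
        by auto
      ultimately show ?thesis by simp
    qed
    then show ?thesis
      by (simp add: poisson_process_prob[OF X A assms(3) \<beta>] p_def q_def p_n)
  qed
  \<comment> \<open>Values in {0, 1} make the second moment equal to the mean, whence the variance
    \<open>p - p\<^sup>2\<close>.\<close>
  have naive_sq: "(naive_estimator A x)\<^sup>2 = naive_estimator A x" for x :: "(real ^ 'd) set"
    by (simp add: naive_estimator_def indicator_def)
  have "P.variance (\<lambda>\<omega>. naive_estimator A (X \<omega>)) = p - p\<^sup>2"
    using P.variance_unit_interval[OF naive_meas]
    by (simp add: naive_sq naive_mean) (simp add: naive_estimator_def indicator_def)
  \<comment> \<open>Values in [0, 1] dominate their squares, so the second moment of the conditional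
    estimator is at most \<open>p\<close>.\<close>
  moreover have "U.expectation (\<lambda>x. (conditional_estimator \<beta> A x)\<^sup>2)
      \<le> U.expectation (conditional_estimator \<beta> A)"
    unfolding cond using cond_meas cond01
    by (intro integral_mono U.integrable_unit_interval)
       (auto simp: power_le_one power2_eq_square intro!: mult_le_one mult_left_le borel_measurable_times)
  ultimately have 2: "U.variance (conditional_estimator \<beta> A)
      \<le> P.variance (\<lambda>\<omega>. naive_estimator A (X \<omega>))"
    using cond_var cond_mean by linarith
  from 1 2 show ?thesis by blast
qed

end
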